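(* There exists an absolute constant $c>0$ such that for all integers $n\ge 5$, \[ r_4(5,n)\ \ge\ 2^{2^{c\,n^{1/5}}}. \]
   Context: For integers $k<s$ and $n$, the Ramsey number $r_k(s,n)$ is the smallest integer $N$ such that every $k$-uniform hypergraph on $N$ vertices contains either a copy of the complete $k$-uniform hypergraph $K_s^{(k)}$ on $s$ vertices or an independent set of size $n$ (a set of $n$ vertices containing no edge). *)

theory Defs
  imports Complex_Main
begin

definition uniform_hypergraph :: "nat \<Rightarrow> 'a set \<Rightarrow> 'a set set \<Rightarrow> bool" where
  "uniform_hypergraph k V E \<longleftrightarrow> (\<forall>e\<in>E. e \<subseteq> V \<and> card e = k)"

definition has_clique :: "nat \<Rightarrow> 'a set \<Rightarrow> 'a set set \<Rightarrow> nat \<Rightarrow> bool" where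
  "has_clique k V E s \<longleftrightarrow>
     (\<exists>S. S \<subseteq> V \<and> card S = s \<and> (\<forall>e. e \<subseteq> S \<and> card e = k \<longrightarrow> e \<in> E))"

definition has_indep :: "nat \<Rightarrow> 'a set \<Rightarrow> 'a set set \<Rightarrow> nat \<Rightarrow> bool" where
  "has_indep k V E n \<longleftrightarrow>
     (\<exists>I. I \<subseteq> V \<and> card I = n \<and> (\<forall>e\<in>E. \<not> e \<subseteq> I))"

definition hyp_ramsey :: "nat \<Rightarrow> nat \<Rightarrow> nat \<Rightarrow> nat" where
  "hyp_ramsey k s n = (LEAST N. \<forall>E. uniform_hypergraph k {..<N} E \<longrightarrow>
       has_clique k {..<N} E s \<or> has_indep k {..<N} E n)"

end

theory Submission
  imports Defs "HOL-Library.Ramsey"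
begin

text \<open>
  The hypergraph is a stepping-up construction on \<open>{0, \<dots>, 2 ^ D - 1}\<close> with \<open>D = 2 ^ q\<close>, seen as the
  leaves of a binary tree whose inner nodes are labelled by their level in \<open>{1..D}\<close>. A random two-colouring \<open>F\<close> of
  the pairs of levels decides which quadruples spanning a path of three inner nodes \<open>c > b > a\<close> are edges.
  With turns L or R at \<open>c\<close> and \<open>b\<close>, the rules are: for LL and RR, that \<open>(F c b, F c a, F b a)\<close> is
  (false, true, false); for RL, \<open>F c b = F c a \<noteq> F b a\<close>; for LR, \<open>F c a = F b a\<close>.
  A case analysis shows that five vertices never span all five edges.

  Let \<open>A\<close> be independent. The rules for LL and RR, together with the randomness of \<open>F\<close>, bound the number of
  left turns and of right turns on the path to any leaf by \<open>t = O(q)\<close>. The rules for LR and RL force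
  relations between the colours of the ancestors of a leaf which become contradictory as soon as the
  turns on its path contain LRLRLR or RLRLRL, followed by one more ancestor. A path is then essentially described by
  five block lengths, each less than \<open>t\<close>, whence \<open>card A \<le> 2 * t ^ 5\<close>.
\<close>

subsection \<open>The edge rule\<close>

definition mixed_triple :: "(nat \<Rightarrow> nat \<Rightarrow> bool) \<Rightarrow> nat \<Rightarrow> nat \<Rightarrow> nat \<Rightarrow> bool" where
  "mixed_triple F a b c \<longleftrightarrow> \<not> F c b \<and> F c a \<and> \<not> F b a"

text \<open>
  The arguments are the levels of the three consecutive splits of a quadruple. If the middle one is
  not the largest, the levels form a chain \<open>c > b > a\<close> of ancestors in the tree, and the four
  disjuncts correspond to the two turns (at \<open>c\<close>, then at \<open>b\<close>) towards \<open>a\<close>: LL, RR, RL, LR. If the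
  middle one is the largest, the quadruple is never an edge.
\<close>

definition edge_rule :: "(nat \<Rightarrow> nat \<Rightarrow> bool) \<Rightarrow> nat \<Rightarrow> nat \<Rightarrow> nat \<Rightarrow> bool" where
  "edge_rule F x y z \<longleftrightarrow>
     (x < y \<and> y < z \<and> mixed_triple F x y z) \<or>
     (z < y \<and> y < x \<and> mixed_triple F z y x) \<or>
     (y < z \<and> z < x \<and> F x z = F x y \<and> F z y \<noteq> F x y) \<or>
     (y < x \<and> x < z \<and> F z y = F x y)"

lemma edge_rule_simps:
  "x < y \<Longrightarrow> y < z \<Longrightarrow> edge_rule F x y z \<longleftrightarrow> mixed_triple F x y z"
  "z < y \<Longrightarrow> y < x \<Longrightarrow> edge_rule F x y z \<longleftrightarrow> mixed_triple F z y x"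
  "y < z \<Longrightarrow> z < x \<Longrightarrow> edge_rule F x y z \<longleftrightarrow> F x z = F x y \<and> F z y \<noteq> F x y"
  "y < x \<Longrightarrow> x < z \<Longrightarrow> edge_rule F x y z \<longleftrightarrow> F z y = F x y"
  by (auto simp: edge_rule_def)

text \<open>The arguments stand for the consecutive split levels of five vertices. Omitting an inner
  vertex merges two of them into their maximum, so the five hypotheses are the five
  quadruples.\<close>

lemma edge_rule_no_clique:
  assumes e: "edge_rule F x y z" "edge_rule F y z w"
    "edge_rule F (max x y) z w" "edge_rule F x (max y z) w" "edge_rule F x y (max z w)"
  shows False
proof -
  \<comment> \<open>An edge never has its largest level in the middle, so the four levels are
    monotone or fall and then rise.\<close>
  have ne: "x \<noteq> y" "y \<noteq> z" "z \<noteq> w" "\<not> (x < y \<and> z < y)" "\<not> (y < z \<and> w < z)"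
    using e(1,2) by (auto simp: edge_rule_def)
  then consider "x < y" "y < z" "z < w" | "y < x" "z < y" "w < z"
    | "y < x" "y < z" "z < w" | "y < x" "z < y" "z < w" by linarith
  then show False
  proof cases
    case 1
    then have "x < z" "y < w" by linarith+
    then show False using 1 e by (simp add: edge_rule_simps mixed_triple_def)
  next
    case 2
    then have "z < x" "w < y" by linarith+
    then show False using 2 e by (simp add: edge_rule_simps mixed_triple_def)
  next
    case 3
    then have m: "max x y = x" "max y z = z" "max z w = w" "y < w" by simp_all
    have "x \<noteq> z" "x \<noteq> w" using e(1,5) 3 m by (auto simp: edge_rule_def)
    then consider "x < z" | "z < x" "x < w" | "w < x" by linarith
    then show False
    proof cases
      case 1
      then have "x < w" using 3 by linarith
      then show False using 3 e 1 m by (simp add: edge_rule_simps mixed_triple_def)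
    next
      case 2
      then show False using 3 e m by (simp add: edge_rule_simps mixed_triple_def)
    next
      case c: 3
      then have "z < x" using 3 by linarith
      then show False using 3 e c m by (auto simp add: edge_rule_simps mixed_triple_def)
    qed
  next
    case 4
    then have m: "max x y = x" "max y z = y" "max z w = w" "z < x" by simp_all
    have "y \<noteq> w" "x \<noteq> w" using e(2,3) 4 m by (auto simp: edge_rule_def)
    then consider "w < y" | "y < w" "w < x" | "x < w" by linarith
    then show False
    proof cases
      case 1
      then have "w < x" using 4 by linarith
      then show False using 4 e 1 m by (simp add: edge_rule_simps mixed_triple_def)
    next
      case 2
      then show False using 4 e m by (auto simp add: edge_rule_simps mixed_triple_def)
    next
      case 3
      then have "y < w" using 4 by linarith
      then show False using 4 e 3 m by (auto simp add: edge_rule_simps mixed_triple_def)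
    qed
  qed
qed

subsection \<open>Split levels and ancestors\<close>

text \<open>
  One plus the position of the highest binary digit in which \<open>u\<close> and \<open>v\<close> differ, for \<open>u \<noteq> v\<close>.
\<close>

definition split_level :: "nat \<Rightarrow> nat \<Rightarrow> nat" where
  "split_level u v = (LEAST k. u div 2 ^ k = v div 2 ^ k)"

lemma split_level_le_iff: "split_level u v \<le> k \<longleftrightarrow> u div 2 ^ k = v div 2 ^ k"
proof
  have ex: "u div 2 ^ (u + v) = v div 2 ^ (u + v)"
  proof -
    have "u + v < 2 ^ (u + v)" by (rule less_exp)
    then have "u < 2 ^ (u + v)" "v < 2 ^ (u + v)" by linarith+
    then show ?thesis by simp
  qed
  assume "split_level u v \<le> k"
  then obtain j where k: "k = split_level u v + j" using le_Suc_ex by blast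
  have "u div 2 ^ split_level u v = v div 2 ^ split_level u v"
    unfolding split_level_def by (rule LeastI) (rule ex)
  then show "u div 2 ^ k = v div 2 ^ k"
    by (simp add: k power_add div_mult2_eq)
next
  assume "u div 2 ^ k = v div 2 ^ k"
  then show "split_level u v \<le> k" unfolding split_level_def by (rule Least_le)
qed

lemma split_level_commute: "split_level u v = split_level v u"
  by (simp add: split_level_def eq_commute)

text \<open>Division by \<open>2 ^ k\<close> is monotone and \<open>v\<close> lies in between, so
  the outer quotients agree iff all three do.\<close>

lemma split_level_trans:
  assumes "u < v" "v < w"
  shows "split_level u w = max (split_level u v) (split_level v w)"
proof -
  have "split_level u w \<le> k \<longleftrightarrow> max (split_level u v) (split_level v w) \<le> k" for k
  proof -
    have "u div 2 ^ k \<le> v div 2 ^ k" "v div 2 ^ k \<le> w div 2 ^ k"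
      using assms by (simp_all add: div_le_mono)
    then show ?thesis by (auto simp: split_level_le_iff)
  qed
  then show ?thesis by (meson order_antisym order_refl)
qed

lemma split_level_pos: "u \<noteq> v \<Longrightarrow> 0 < split_level u v"
  using split_level_le_iff[of u v 0] by auto

lemma split_level_le: "u < 2 ^ D \<Longrightarrow> v < 2 ^ D \<Longrightarrow> split_level u v \<le> D"
  by (simp add: split_level_le_iff)

text \<open>Equal levels \<open>Suc k\<close> would give three distinct quotients by
  \<open>2 ^ k\<close> with the same half, but only two numbers share a half.\<close>

lemma split_level_neq:
  assumes "u < v" "v < w"
  shows "split_level u v \<noteq> split_level v w"
proof
  assume eq: "split_level u v = split_level v w"
  obtain k where k: "split_level u v = Suc k" using split_level_pos[of u v] assms by (cases "split_level u v") auto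
  have half: "n div 2 ^ Suc k = n div 2 ^ k div 2" for n :: nat
    by (metis div_mult2_eq power_Suc2)
  have "\<not> split_level u v \<le> k" "\<not> split_level v w \<le> k" "split_level u v \<le> Suc k" "split_level v w \<le> Suc k"
    using eq k by auto
  then have "u div 2 ^ k \<noteq> v div 2 ^ k" "v div 2 ^ k \<noteq> w div 2 ^ k"
    "u div 2 ^ k div 2 = v div 2 ^ k div 2" "v div 2 ^ k div 2 = w div 2 ^ k div 2"
    unfolding split_level_le_iff half by simp_all
  moreover have "u div 2 ^ k \<le> v div 2 ^ k" "v div 2 ^ k \<le> w div 2 ^ k"
    using assms by (simp_all add: div_le_mono)
  ultimately show False by linarith
qed

text \<open>The flag reverses the order, so that mirror-image arguments for the two turns can share
  one proof.\<close>

definition before :: "bool \<Rightarrow> nat \<Rightarrow> nat \<Rightarrow> bool" where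
  "before d u v \<longleftrightarrow> (if d then u < v else v < u)"

text \<open>
  View the elements of \<open>A\<close> as the leaves of a binary tree. Then \<open>anc A d e y\<close> says that the leaf \<open>e\<close> has
  an ancestor at level \<open>y\<close> and lies in its right subtree (\<open>d = True\<close>) or left subtree (\<open>d = False\<close>).
\<close>

definition anc :: "nat set \<Rightarrow> bool \<Rightarrow> nat \<Rightarrow> nat \<Rightarrow> bool" where
  "anc A d e y \<longleftrightarrow> (\<exists>u\<in>A. before d u e \<and> split_level u e = y)"

lemma before_irrefl: "before d u v \<Longrightarrow> u \<noteq> v" by (auto simp: before_def)
lemma before_flip: "before (\<not> d) u v \<longleftrightarrow> before d v u" by (auto simp: before_def)
lemma before_linear: "u \<noteq> v \<Longrightarrow> before d u v \<or> before d v u" by (auto simp: before_def)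

lemma split_level_before:
  assumes "before d u v" "before d v w"
  shows "split_level u w = max (split_level u v) (split_level v w)" "split_level u v \<noteq> split_level v w"
  using assms split_level_trans[of u v w] split_level_trans[of w v u] split_level_neq[of u v w] split_level_neq[of w v u]
  by (auto simp: before_def split_level_commute max.commute split: if_splits)

text \<open>Levels combine by maximum, so of two leaves on one side of \<open>e\<close> the one
  splitting off higher is farther away. This sorts the witnesses of ancestors.\<close>

lemma before_if_split_level_less:
  assumes "before d u e" "before d v e" "split_level v e < split_level u e"
  shows "before d u v" "split_level u v = split_level u e"
proof -
  have "u \<noteq> v" using assms(3) by auto
  moreover have "\<not> before d v u"
    using split_level_before(1)[of d v u e] assms by auto
  ultimately show "before d u v" using before_linear by blast
  then show "split_level u v = split_level u e"
    using split_level_before[of d u v e] assms by (auto simp: max_def split: if_splits)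
qed

subsection \<open>Independent sets\<close>

definition indep_set :: "(nat \<Rightarrow> nat \<Rightarrow> bool) \<Rightarrow> nat set \<Rightarrow> bool" where
  "indep_set F A \<longleftrightarrow> (\<forall>v1\<in>A. \<forall>v2\<in>A. \<forall>v3\<in>A. \<forall>v4\<in>A. v1 < v2 \<longrightarrow> v2 < v3 \<longrightarrow> v3 < v4 \<longrightarrow>
     \<not> edge_rule F (split_level v1 v2) (split_level v2 v3) (split_level v3 v4))"

lemma indep_setD:
  assumes "indep_set F A" "v1 \<in> A" "v2 \<in> A" "v3 \<in> A" "v4 \<in> A" "v1 < v2" "v2 < v3" "v3 < v4"
  shows "\<not> edge_rule F (split_level v1 v2) (split_level v2 v3) (split_level v3 v4)"
  using assms unfolding indep_set_def by blast

text \<open>With witnesses \<open>u\<close>, \<open>v\<close>, \<open>w\<close> of \<open>c\<close>,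
  \<open>b\<close>, \<open>a\<close>, the sorted quadruple is \<open>v, w, e, u\<close> or
  \<open>v, e, w, u\<close>. Both have split levels \<open>b, a, c\<close>, so the same relation
  results for either turn at \<open>a\<close>.\<close>

lemma anc_LR:
  assumes A: "indep_set F A" "e \<in> A" and c: "anc A False e c" and b: "anc A True e b"
    and a: "anc A d e a" and lt: "a < b" "b < c"
  shows "F c a \<noteq> F b a"
proof -
  obtain u where u: "u \<in> A" "e < u" "split_level e u = c" using c by (auto simp: anc_def before_def split_level_commute)
  obtain v where v: "v \<in> A" "v < e" "split_level v e = b" using b by (auto simp: anc_def before_def)
  obtain w where w: "w \<in> A" "before d w e" "split_level w e = a" using a by (auto simp: anc_def)
  have "\<not> edge_rule F b a c"
  proof (cases d)
    case True
    then have "v < w" "split_level v w = b"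
      using before_if_split_level_less[of True v e w] v w lt by (auto simp: before_def)
    then show ?thesis
      using indep_setD[OF A(1), of v w e u] A(2) u v w True by (auto simp: before_def)
  next
    case False
    then have "w < u" "split_level w u = c"
      using before_if_split_level_less[of False u e w] u w lt by (auto simp: before_def split_level_commute)
    then show ?thesis
      using indep_setD[OF A(1), of v e w u] A(2) u v w False by (auto simp: before_def split_level_commute)
  qed
  then show ?thesis using lt by (auto simp: edge_rule_def)
qed

text \<open>As for LR, but the quadruple is \<open>u, w, e, v\<close> or \<open>u, e, w, v\<close>,
  with split levels \<open>c, a, b\<close>.\<close>

lemma anc_RL:
  assumes A: "indep_set F A" "e \<in> A" and c: "anc A True e c" and b: "anc A False e b"
    and a: "anc A d e a" and lt: "a < b" "b < c"
  shows "F c b = F c a \<Longrightarrow> F b a = F c a"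
proof -
  obtain u where u: "u \<in> A" "u < e" "split_level u e = c" using c by (auto simp: anc_def before_def)
  obtain v where v: "v \<in> A" "e < v" "split_level e v = b" using b by (auto simp: anc_def before_def split_level_commute)
  obtain w where w: "w \<in> A" "before d w e" "split_level w e = a" using a by (auto simp: anc_def)
  have "\<not> edge_rule F c a b"
  proof (cases d)
    case True
    then have "u < w" "split_level u w = c"
      using before_if_split_level_less[of True u e w] u w lt by (auto simp: before_def)
    then show ?thesis
      using indep_setD[OF A(1), of u w e v] A(2) u v w True by (auto simp: before_def)
  next
    case False
    then have "w < v" "split_level w v = b"
      using before_if_split_level_less[of False v e w] v w lt by (auto simp: before_def split_level_commute)
    then show ?thesis
      using indep_setD[OF A(1), of u e w v] A(2) u v w False by (auto simp: before_def split_level_commute)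
  qed
  then show "F c b = F c a \<Longrightarrow> F b a = F c a" using lt by (auto simp: edge_rule_def)
qed

text \<open>The witnesses \<open>u\<close>, \<open>v\<close>, \<open>w\<close> and then
  \<open>e\<close> form a monotone sequence with split levels \<open>c, b, a\<close>.\<close>

lemma anc_same:
  assumes A: "indep_set F A" "e \<in> A" and c: "anc A d e c" and b: "anc A d e b"
    and a: "anc A d e a" and lt: "a < b" "b < c"
  shows "\<not> mixed_triple F a b c"
proof -
  obtain u where u: "u \<in> A" "before d u e" "split_level u e = c" using c by (auto simp: anc_def)
  obtain v where v: "v \<in> A" "before d v e" "split_level v e = b" using b by (auto simp: anc_def)
  obtain w where w: "w \<in> A" "before d w e" "split_level w e = a" using a by (auto simp: anc_def)
  have 1: "before d u v" "split_level u v = c" using before_if_split_level_less[of d u e v] u v lt by auto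
  have 2: "before d v w" "split_level v w = b" using before_if_split_level_less[of d v e w] v w lt by auto
  show ?thesis
  proof (cases d)
    case True
    then have "\<not> edge_rule F c b a"
      using indep_setD[OF A(1), of u v w e] A(2) u v w 1 2 by (auto simp: before_def)
    then show ?thesis using lt by (auto simp: edge_rule_def)
  next
    case False
    then have "\<not> edge_rule F a b c"
      using indep_setD[OF A(1), of e w v u] A(2) u v w 1 2 by (auto simp: before_def split_level_commute)
    then show ?thesis using lt by (auto simp: edge_rule_def)
  qed
qed

text \<open>
  Below level \<open>m\<close>, the leaf \<open>e\<close> has \<open>k\<close> ancestors of decreasing levels with alternating turns, the first
  one being \<open>d\<close>, followed by one more ancestor (the tail) whose turn is irrelevant.
\<close>

fun tailed_chain :: "nat set \<Rightarrow> nat \<Rightarrow> bool \<Rightarrow> nat \<Rightarrow> nat \<Rightarrow> bool" where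
  "tailed_chain A e d 0 m \<longleftrightarrow> (\<exists>d'. \<exists>y<m. anc A d' e y)"
| "tailed_chain A e d (Suc k) m \<longleftrightarrow> (\<exists>y<m. anc A d e y \<and> tailed_chain A e (\<not> d) k y)"

lemma no_tailed_chain_6:
  assumes A: "indep_set F A" "e \<in> A"
  shows "\<not> tailed_chain A e d 6 m"
proof
  assume "tailed_chain A e d 6 m"
  then obtain c1 c2 c3 c4 c5 c6 a d' where lt: "c2 < c1" "c3 < c2" "c4 < c3" "c5 < c4" "c6 < c5" "a < c6"
    and an: "anc A d e c1" "anc A (\<not> d) e c2" "anc A d e c3" "anc A (\<not> d) e c4" "anc A d e c5"
      "anc A (\<not> d) e c6" "anc A d' e a"
    by (auto simp: numeral_eq_Suc)
  show False
  proof (cases d)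
    case False
    note LR = anc_LR[OF A] and RL = anc_RL[OF A]
    have an: "anc A False e c1" "anc A True e c2" "anc A False e c3" "anc A True e c4" "anc A False e c5"
      "anc A True e c6" "anc A d' e a"
      using an False by simp_all
    have lt2: "c3 < c1" "c4 < c1" "c5 < c1" "c6 < c1" "a < c1" "c4 < c2" "c5 < c2" "c6 < c2" "a < c2"
      "c5 < c3" "c6 < c3" "a < c3" "c6 < c4" "a < c4" "a < c5" using lt by linarith+
    \<comment> \<open>These make \<open>F ci a\<close> alternate with the parity of
      \<open>i\<close>. The RL relations then give \<open>F c2 c3\<close>, \<open>F c2 c5\<close>
      and \<open>F c4 c5\<close> the odd value, hence also \<open>F c3 c5\<close>, against
      \<open>F c3 c5 \<noteq> F c4 c5\<close>.\<close>
    have "F c1 a \<noteq> F c2 a" "F c1 a \<noteq> F c4 a" "F c1 a \<noteq> F c6 a" "F c3 a \<noteq> F c6 a" "F c5 a \<noteq> F c6 a"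
      by (rule LR; use an lt lt2 in blast)+
    moreover have "F c3 c5 \<noteq> F c4 c5" "F c1 c5 \<noteq> F c4 c5"
      by (rule LR; use an lt lt2 in blast)+
    moreover have "F c2 c3 = F c2 a \<Longrightarrow> F c3 a = F c2 a" "F c2 c5 = F c2 a \<Longrightarrow> F c5 a = F c2 a"
      "F c4 c5 = F c4 a \<Longrightarrow> F c5 a = F c4 a" "F c2 c3 = F c2 c5 \<Longrightarrow> F c3 c5 = F c2 c5"
      by (rule RL; use an lt lt2 in blast)+
    ultimately show False by argo
  next
    case True
    note LR = anc_LR[OF A] and RL = anc_RL[OF A]
    have an: "anc A True e c1" "anc A False e c2" "anc A True e c3" "anc A False e c4" "anc A True e c5"
      "anc A False e c6" "anc A d' e a"
      using an True by simp_all
    have lt2: "c3 < c1" "c4 < c1" "c5 < c1" "c6 < c1" "a < c1" "c4 < c2" "c5 < c2" "c6 < c2" "a < c2"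
      "c5 < c3" "c6 < c3" "a < c3" "c6 < c4" "a < c4" "a < c5" using lt by linarith+
    \<comment> \<open>Let \<open>s = F c2 a\<close>. Then \<open>F c4 a\<close>,
      \<open>F c3 c4\<close>, \<open>F c2 c6\<close> and \<open>F c4 c6\<close> equal
      \<open>s\<close>, while \<open>F c2 c4\<close>, \<open>F c3 a\<close>, \<open>F c3 c6\<close>
      and thus \<open>F c6 a\<close> differ from \<open>s\<close>. Either value of
      \<open>F c1 a\<close> forces \<open>F c1 c2 = F c1 c4 = s\<close> (if it is \<open>s\<close>,
      by way of \<open>F c1 c6 \<noteq> s\<close>), hence \<open>F c2 c4 = s\<close>, a
      contradiction.\<close>
    have "F c2 a \<noteq> F c3 a" "F c2 a \<noteq> F c5 a" "F c4 a \<noteq> F c5 a"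
      "F c2 c6 \<noteq> F c3 c6" "F c2 c6 \<noteq> F c5 c6" "F c4 c6 \<noteq> F c5 c6" "F c2 c4 \<noteq> F c3 c4"
      by (rule LR; use an lt lt2 in blast)+
    moreover have 
      "F c1 c2 = F c1 a \<Longrightarrow> F c2 a = F c1 a" "F c1 c4 = F c1 a \<Longrightarrow> F c4 a = F c1 a"
      "F c1 c6 = F c1 a \<Longrightarrow> F c6 a = F c1 a" "F c3 c4 = F c3 a \<Longrightarrow> F c4 a = F c3 a"
      "F c3 c6 = F c3 a \<Longrightarrow> F c6 a = F c3 a" "F c5 c6 = F c5 a \<Longrightarrow> F c6 a = F c5 a"
      "F c1 c2 = F c1 c6 \<Longrightarrow> F c2 c6 = F c1 c6" "F c1 c4 = F c1 c6 \<Longrightarrow> F c4 c6 = F c1 c6"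
      "F c3 c4 = F c3 c6 \<Longrightarrow> F c4 c6 = F c3 c6" "F c1 c2 = F c1 c4 \<Longrightarrow> F c2 c4 = F c1 c4"
      by (rule RL; use an lt lt2 in blast)+
    ultimately show False by argo
  qed
qed

section \<open>From forbidden turn patterns to a bound on the number of leaves\<close>

lemma tailed_chain_weaken: "tailed_chain A e d k m \<Longrightarrow> m \<le> m' \<Longrightarrow> tailed_chain A e d k m'"
  by (cases k) (auto intro: less_le_trans)

text \<open>Every level of a chain inside \<open>Q\<close> is below \<open>y\<close>, so the chain
  can later be prefixed by an ancestor at level \<open>y\<close>.\<close>

lemma tailed_chain_mono:
  assumes "tailed_chain Q e d k m" "Q \<subseteq> A" "\<And>u. u \<in> Q \<Longrightarrow> u \<noteq> e \<Longrightarrow> split_level u e < y"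
  shows "tailed_chain A e d k y"
proof -
  have "tailed_chain A e d k (min m y)"
    using assms(1)
  proof (induction k arbitrary: d m)
    case 0
    then show ?case using assms(2,3) before_irrefl by (fastforce simp: anc_def)
  next
    case (Suc k)
    then obtain z where z: "z < m" "anc Q d e z" "tailed_chain Q e (\<not> d) k z" by auto
    have "z < y" using z(2) assms(3) before_irrefl by (auto simp: anc_def)
    then have "tailed_chain A e (\<not> d) k z" using Suc.IH[OF z(3)] by (simp add: min_absorb1)
    moreover have "anc A d e z" using z(2) assms(2) by (auto simp: anc_def)
    ultimately show ?case using z(1) \<open>z < y\<close> by auto
  qed
  then show ?thesis by (rule tailed_chain_weaken) simp
qed

lemma split_level_less_same_side:
  assumes "before d f u" "before d f v" "split_level f u = y" "split_level f v = y" "u \<noteq> v"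
  shows "split_level u v < y"
proof -
  have "split_level u v < y" if "before d u v" "before d f u" "split_level f u = y" "split_level f v = y" for u v
    using split_level_before[OF that(2,1)] that by (auto simp: max_def split: if_splits)
  then show ?thesis using before_linear[OF assms(5), of d] assms split_level_commute by metis
qed

lemma finite_anc: "finite A \<Longrightarrow> finite {y. anc A d e y}"
  by (rule finite_subset[of _ "(\<lambda>u. split_level u e) ` A"]) (auto simp: anc_def)

lemma ex_extremal:
  assumes "finite A" "A \<noteq> {}"
  obtains e where "e \<in> A" "\<And>u. u \<in> A \<Longrightarrow> u \<noteq> e \<Longrightarrow> before d e u"
proof (cases d)
  case True
  have "before d (Min A) u" if "u \<in> A" "u \<noteq> Min A" for u
    using that Min_le[OF assms(1) that(1)] True by (simp add: before_def)
  then show ?thesis using that[of "Min A"] assms by simp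
next
  case False
  have "before d (Max A) u" if "u \<in> A" "u \<noteq> Max A" for u
    using that Max_ge[OF assms(1) that(1)] False by (simp add: before_def)
  then show ?thesis using that[of "Max A"] assms by simp
qed

text \<open>Induction on \<open>k\<close>: in a subtree entered by the turn \<open>d\<close>, a
  chain of \<open>k\<close> turns starting with \<open>\<not> d\<close> would extend to one of
  \<open>Suc k\<close> turns starting with \<open>d\<close>.\<close>

lemma card_le_if_no_tailed_chain:
  assumes "finite A" "\<And>d e. e \<in> A \<Longrightarrow> card {y. anc A d e y} < t"
    and "\<And>e m. e \<in> A \<Longrightarrow> \<not> tailed_chain A e d k m"
  shows "card A \<le> t ^ k"
  using assms
proof (induction k arbitrary: A d)
  case 0
  have "u = v" if uv: "u \<in> A" "v \<in> A" for u v
  proof (rule ccontr)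
    assume "u \<noteq> v"
    then have "anc A (u < v) v (split_level u v)" using uv by (auto simp: anc_def before_def)
    then have "tailed_chain A v d 0 (Suc (split_level u v))" by auto
    then show False using 0 uv by blast
  qed
  then have "card A \<le> Suc 0"
    by (metis card_le_Suc0_iff_eq 0(1))
  then show ?case by simp
next
  case (Suc k)
  show ?case
  proof (cases "A = {}")
    case False
    \<comment> \<open>All turns towards the extremal leaf \<open>e\<close> are \<open>\<not> d\<close>, so every other leaf first leaves that path by
      turning \<open>d\<close> at one of fewer than \<open>t\<close> levels.\<close>
    obtain e where e: "e \<in> A" "\<And>u. u \<in> A \<Longrightarrow> u \<noteq> e \<Longrightarrow> before d e u"
      using ex_extremal[OF Suc.prems(1) False] by metis
    define Q where "Q y = {u \<in> A. before d e u \<and> split_level e u = y}" for y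
    define Y where "Y = {y. anc A (\<not> d) e y}"
    have Q: "card (Q y) \<le> t ^ k" for y
    proof (rule Suc.IH[of _ "\<not> d"])
      show "finite (Q y)" using Suc.prems(1) by (simp add: Q_def)
      fix u assume u: "u \<in> Q y"
      show "card {z. anc (Q y) d' u z} < t" for d'
      proof -
        have "card {z. anc (Q y) d' u z} \<le> card {z. anc A d' u z}"
          by (rule card_mono[OF finite_anc[OF Suc.prems(1)]]) (auto simp: anc_def Q_def)
        then show ?thesis using Suc.prems(2)[of u d'] u by (simp add: Q_def)
      qed
      show "\<not> tailed_chain (Q y) u (\<not> d) k m" for m
      proof
        assume t: "tailed_chain (Q y) u (\<not> d) k m"
        have less: "split_level v u < y" if "v \<in> Q y" "v \<noteq> u" for v
          using split_level_less_same_side[of d e v u y] that u by (simp add: Q_def)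
        have "tailed_chain A u (\<not> d) k y"
          by (rule tailed_chain_mono[OF t _ less]) (auto simp: Q_def)
        moreover have "anc A d u y" using u e(1) by (auto simp: anc_def Q_def)
        ultimately have "tailed_chain A u d (Suc k) (Suc y)" by auto
        then show False using Suc.prems(3) u by (auto simp: Q_def simp del: tailed_chain.simps)
      qed
    qed
    have "A = insert e (\<Union>y\<in>Y. Q y)"
      using e by (fastforce simp: Q_def Y_def anc_def before_flip split_level_commute)
    moreover have "finite Y" using finite_anc[OF Suc.prems(1)] by (simp add: Y_def)
    ultimately have "card A \<le> Suc (card (\<Union>y\<in>Y. Q y))"
      by (metis card_insert_if le_SucI order_refl Suc.prems(1) finite_insert)
    also have "\<dots> \<le> Suc (\<Sum>y\<in>Y. card (Q y))" using card_UN_le[OF \<open>finite Y\<close>] by simp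
    also have "\<dots> \<le> Suc (card Y * t ^ k)" using sum_bounded_above[of Y "\<lambda>y. card (Q y)" "t ^ k"] Q by simp
    finally have 1: "card A \<le> Suc (card Y * t ^ k)" .
    \<comment> \<open>The strict bound on the number of turns leaves room for the summand 1 of the
      leaf \<open>e\<close>.\<close>
    have "Suc (card Y) \<le> t" using Suc.prems(2)[OF e(1), of "\<not> d"] by (simp add: Y_def)
    then have "Suc (card Y) * t ^ k \<le> t * t ^ k" by (rule mult_le_mono1)
    moreover have "1 \<le> t ^ k" using \<open>Suc (card Y) \<le> t\<close> by (simp add: Suc_le_eq)
    ultimately show ?thesis using 1 by simp
  qed simp
qed

text \<open>Excluding six-turn chains directly would give \<open>t ^ 6\<close>. Splitting at the
  root first saves a factor: a leaf in the right half turns R there, so it has no five-turn chain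
  starting with L, and symmetrically on the left.\<close>

lemma card_indep_set_le:
  assumes fin: "finite A" and ind: "indep_set F A"
    and t: "\<And>d e. e \<in> A \<Longrightarrow> card {y. anc A d e y} < t"
  shows "card A \<le> 2 * t ^ 5"
proof (cases "\<exists>f\<in>A. \<exists>g\<in>A. f \<noteq> g")
  case False
  then have "card A \<le> 1" using card_le_Suc0_iff_eq[OF fin] by auto
  moreover have "1 \<le> t ^ 5" if "A \<noteq> {}"
  proof -
    have "0 < t" using t that by fastforce
    then show ?thesis by (simp add: Suc_le_eq)
  qed
  ultimately show ?thesis
    by (cases "A = {}") (simp, linarith)
next
  case True
  then have "A \<noteq> {}" by blast
  define f g where "f = Min A" and "g = Max A"
  have fg: "f \<in> A" "g \<in> A" "\<And>u. u \<in> A \<Longrightarrow> f \<le> u \<and> u \<le> g"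
    using fin \<open>A \<noteq> {}\<close> by (simp_all add: f_def g_def)
  have "f < g" using True fg by (metis order.strict_iff_order order_antisym)
  define y where "y = split_level f g"
  \<comment> \<open>\<open>Q True f\<close> and \<open>Q False g\<close> are the right and left
    halves below the root, whose level is \<open>y\<close>.\<close>
  define Q where "Q d h = {u \<in> A. before d h u \<and> split_level h u = y}" for d h
  have half: "card (Q d h) \<le> t ^ 5" if h: "h \<in> A" for d h
  proof (rule card_le_if_no_tailed_chain[of _ _ "\<not> d"])
    show "finite (Q d h)" using fin by (simp add: Q_def)
    fix u assume u: "u \<in> Q d h"
    show "card {z. anc (Q d h) d' u z} < t" for d'
    proof -
      have "card {z. anc (Q d h) d' u z} \<le> card {z. anc A d' u z}"
        by (rule card_mono[OF finite_anc[OF fin]]) (auto simp: anc_def Q_def)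
      then show ?thesis using t[of u d'] u by (simp add: Q_def)
    qed
    show "\<not> tailed_chain (Q d h) u (\<not> d) 5 m" for m
    proof
      assume t: "tailed_chain (Q d h) u (\<not> d) 5 m"
      have less: "split_level v u < y" if "v \<in> Q d h" "v \<noteq> u" for v
        using split_level_less_same_side[of d h v u y] that u by (simp add: Q_def)
      have "tailed_chain A u (\<not> d) 5 y"
        by (rule tailed_chain_mono[OF t _ less]) (auto simp: Q_def)
      moreover have "anc A d u y" using u h by (auto simp: anc_def Q_def)
      ultimately have "tailed_chain A u d (Suc 5) (Suc y)"
        unfolding tailed_chain.simps(2) by blast
      then show False using no_tailed_chain_6[OF ind, of u d "Suc y"] u
        by (simp add: Q_def del: tailed_chain.simps)
    qed
  qed
  have "u \<in> Q True f \<union> Q False g" if u: "u \<in> A" for u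
  proof -
    consider "u = f" | "u = g" | "f < u" "u < g" using fg(3)[OF u] by linarith
    then show ?thesis
    proof cases
      case 3
      then have "y = max (split_level f u) (split_level u g)" unfolding y_def by (rule split_level_trans)
      then show ?thesis using 3 u by (auto simp: Q_def before_def split_level_commute max_def)
    qed (use \<open>f < g\<close> fg in \<open>auto simp: Q_def before_def y_def split_level_commute\<close>)
  qed
  then have "card A \<le> card (Q True f \<union> Q False g)"
    using fin by (intro card_mono) (auto simp: Q_def)
  also have "\<dots> \<le> card (Q True f) + card (Q False g)" by (rule card_Un_le)
  also have "\<dots> \<le> 2 * t ^ 5" using half[OF fg(1), of True] half[OF fg(2), of False] by linarith
  finally show ?thesis .
qed

subsection \<open>A colouring with many mixed triples\<close>

text \<open>In probabilistic terms, the traces of a random \<open>S\<close> on disjoint triples are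
  independent, and each avoids its forbidden value with probability 7/8; denominators are
  cleared.\<close>

lemma card_avoiding_le:
  assumes "finite I" "finite E" "\<And>i. i \<in> I \<Longrightarrow> P i \<subseteq> E" "\<And>i. i \<in> I \<Longrightarrow> card (P i) = 3"
    and "\<And>i. i \<in> I \<Longrightarrow> f i \<subseteq> P i"
    and "\<And>i j. i \<in> I \<Longrightarrow> j \<in> I \<Longrightarrow> i \<noteq> j \<Longrightarrow> P i \<inter> P j = {}"
  shows "card {S. S \<subseteq> E \<and> (\<forall>i\<in>I. S \<inter> P i \<noteq> f i)} * 8 ^ card I \<le> 7 ^ card I * 2 ^ card E"
  using assms
proof (induction I arbitrary: E rule: finite_induct)
  case empty
  then show ?case by (simp add: card_Pow flip: Pow_def)
next
  case (insert j I)
  let ?C = "\<lambda>E I. {S. S \<subseteq> E \<and> (\<forall>i\<in>I. S \<inter> P i \<noteq> f i)}"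
  let ?E = "E - P j"
  have Pj: "P j \<subseteq> E" "card (P j) = 3" "f j \<subseteq> P j" using insert.prems by auto
  have finPj: "finite (P j)" using Pj(1) insert.prems(1) finite_subset by blast
  have disj: "P i \<inter> P j = {}" if "i \<in> I" for i
    using insert.prems(5)[of i j] that insert.hyps(2) by auto
  have IH: "card (?C ?E I) * 8 ^ card I \<le> 7 ^ card I * 2 ^ card ?E"
  proof (rule insert.IH)
    show "P i \<subseteq> ?E" if "i \<in> I" for i using insert.prems(2)[of i] disj[OF that] that by blast
  qed (use insert.prems in auto)
  \<comment> \<open>\<open>S\<close> is determined by its trace on \<open>P j\<close>, for which 7
    values remain, and by the rest.\<close>
  have "card (?C E (insert j I)) \<le> card ((Pow (P j) - {f j}) \<times> ?C ?E I)"
  proof (rule card_inj_on_le[where f = "\<lambda>S. (S \<inter> P j, S - P j)"])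
    show "inj_on (\<lambda>S. (S \<inter> P j, S - P j)) (?C E (insert j I))" by (rule inj_onI) blast
    show "(\<lambda>S. (S \<inter> P j, S - P j)) ` ?C E (insert j I) \<subseteq> (Pow (P j) - {f j}) \<times> ?C ?E I"
    proof -
      have "(S - P j) \<inter> P i = S \<inter> P i" if "i \<in> I" for S i using disj[OF that] by blast
      then show ?thesis by auto
    qed
    show "finite ((Pow (P j) - {f j}) \<times> ?C ?E I)"
      using finPj insert.prems(1) by (intro finite_cartesian_product) auto
  qed
  also have "\<dots> = 7 * card (?C ?E I)"
    using Pj finPj by (simp add: card_cartesian_product card_Diff_singleton card_Pow)
  finally have le: "card (?C E (insert j I)) \<le> 7 * card (?C ?E I)" .
  have "card E = card ?E + 3"
    using card_Diff_subset[OF finPj Pj(1)] Pj card_mono[OF insert.prems(1) Pj(1)] by linarith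
  then have E: "(2::nat) ^ card E = 8 * 2 ^ card ?E" by (simp add: power_add)
  have "card (?C E (insert j I)) * 8 ^ card (insert j I) \<le> (7 * card (?C ?E I)) * (8 * 8 ^ card I)"
    using le insert.hyps by (simp add: mult_le_mono1)
  also have "\<dots> = 56 * (card (?C ?E I) * 8 ^ card I)" by simp
  also have "\<dots> \<le> 56 * (7 ^ card I * 2 ^ card ?E)" using IH by simp
  also have "\<dots> = 7 ^ card (insert j I) * 2 ^ card E" using insert.hyps E by simp
  finally show ?case .
qed

text \<open>It suffices to examine \<open>p * p\<close> triples in \<open>K\<close> no two of which
  share a pair; under a random \<open>S\<close> these are mixed independently, each with probability
  1/8.\<close>

lemma card_colourings_without_mixed_triple:
  fixes K :: "nat set"
  assumes K: "K \<subseteq> V" "card K = 3 * p" "finite V"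
  shows "card {S. S \<subseteq> V \<times> V \<and>
           (\<forall>a\<in>K. \<forall>b\<in>K. \<forall>c\<in>K. a < b \<longrightarrow> b < c \<longrightarrow> \<not> mixed_triple (\<lambda>x y. (x, y) \<in> S) a b c)} * 8 ^ (p * p)
         \<le> 7 ^ (p * p) * 2 ^ card (V \<times> V)"
    (is "card ?B * _ \<le> _")
proof -
  have finK: "finite K" using K finite_subset by blast
  define l where "l = sorted_list_of_set K"
  have l: "length l = 3 * p" "set l = K" using K finK by (simp_all add: l_def)
  have gl: "l ! i < l ! j" if "i < j" "j < 3 * p" for i j
    using that sorted_wrt_nth_less[OF strict_sorted_list_of_set[of K], of i j] l by (simp add: l_def)
  have ginj: "l ! i = l ! j \<longleftrightarrow> i = j" if "i < 3 * p" "j < 3 * p" for i j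
    using gl[of i j] gl[of j i] that by (cases i j rule: linorder_cases) auto
  have gK: "l ! i \<in> K" if "i < 3 * p" for i using nth_mem[of i l] that l by simp
  \<comment> \<open>Any two of \<open>i\<close>, \<open>j\<close>, \<open>(i + j) mod p\<close> determine the third, so these \<open>p\<^sup>2\<close> triples share no pair.\<close>
  let ?I = "{..<p} \<times> {..<p}"
  define a where "a = (\<lambda>(i, j :: nat). l ! i)"
  define b where "b = (\<lambda>(i :: nat, j). l ! (p + j))"
  define c where "c = (\<lambda>(i, j). l ! (2 * p + (i + j) mod p))"
  define P where "P x = {(c x, b x), (c x, a x), (b x, a x)}" for x
  have ord: "a x < b x" "b x < c x" "a x \<in> K" "b x \<in> K" "c x \<in> K" if "x \<in> ?I" for x
  proof -
    obtain i j where x: "x = (i, j)" "i < p" "j < p" using \<open>x \<in> ?I\<close> by auto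
    have "(i + j) mod p < p" using x by simp
    then show "a x < b x" "b x < c x" "a x \<in> K" "b x \<in> K" "c x \<in> K"
      using x by (auto simp: a_def b_def c_def intro!: gl gK)
  qed
  have card3: "card (P x) = 3" if "x \<in> ?I" for x
    using ord[OF that] by (simp add: P_def)
  have disj: "P x \<inter> P y = {}" if xy: "x \<in> ?I" "y \<in> ?I" "x \<noteq> y" for x y
  proof -
    obtain i j i' j' where x: "x = (i, j)" "i < p" "j < p" and y: "y = (i', j')" "i' < p" "j' < p"
      using xy by auto
    define k where "k = (i + j) mod p"
    define k' where "k' = (i' + j') mod p"
    have k: "k < p" "k' < p" using x by (simp_all add: k_def k'_def)
    have mod: "k = (if i + j < p then i + j else i + j - p)" "k' = (if i' + j' < p then i' + j' else i' + j' - p)"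
      using x y by (simp_all add: k_def k'_def le_mod_geq)
    have 1: "j = j'" if "i = i'" "k = k'"
      using that x y mod by (auto split: if_splits)
    have 2: "i = i'" if "j = j'" "k = k'"
      using that x y mod by (auto split: if_splits)
    have ne: "i \<noteq> i' \<or> j \<noteq> j'" using x y xy by auto
    have eqs: "a x = l ! i" "b x = l ! (p + j)" "c x = l ! (2 * p + k)"
      "a y = l ! i'" "b y = l ! (p + j')" "c y = l ! (2 * p + k')"
      by (simp_all add: a_def b_def c_def x y k_def k'_def)
    have "a x = a y \<longleftrightarrow> i = i'" "b x = b y \<longleftrightarrow> j = j'" "c x = c y \<longleftrightarrow> k = k'"
      "a x \<noteq> b y" "b x \<noteq> a y" "b x \<noteq> c y" "c x \<noteq> b y"
      unfolding eqs using x y k by (simp_all add: ginj)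
    moreover from this have "\<not> (c x = c y \<and> b x = b y)" "\<not> (c x = c y \<and> a x = a y)" "\<not> (b x = b y \<and> a x = a y)"
      using 1 2 ne by blast+
    ultimately show ?thesis unfolding P_def by blast
  qed
  \<comment> \<open>The trace \<open>{(c x, a x)}\<close> on \<open>P x\<close> says exactly that
    the triple of \<open>x\<close> is mixed.\<close>
  have "card {S. S \<subseteq> V \<times> V \<and> (\<forall>x\<in>?I. S \<inter> P x \<noteq> {(c x, a x)})} * 8 ^ card ?I
        \<le> 7 ^ card ?I * 2 ^ card (V \<times> V)"
  proof (rule card_avoiding_le)
    show "P x \<subseteq> V \<times> V" if "x \<in> ?I" for x using ord[OF that] K(1) by (auto simp: P_def)
    show "{(c x, a x)} \<subseteq> P x" for x by (simp add: P_def)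
  qed (use K(3) card3 disj in auto)
  moreover have "card ?B \<le> card {S. S \<subseteq> V \<times> V \<and> (\<forall>x\<in>?I. S \<inter> P x \<noteq> {(c x, a x)})}"
  proof (rule card_mono)
    show "finite {S. S \<subseteq> V \<times> V \<and> (\<forall>x\<in>?I. S \<inter> P x \<noteq> {(c x, a x)})}"
      using K(3) by (intro finite_subset[OF _ finite_Pow_iff[THEN iffD2, of "V \<times> V"]]) auto
    show "?B \<subseteq> {S. S \<subseteq> V \<times> V \<and> (\<forall>x\<in>?I. S \<inter> P x \<noteq> {(c x, a x)})}"
    proof (intro subsetI CollectI conjI ballI notI)
      fix S x assume S: "S \<in> ?B" and x: "x \<in> ?I" and eq: "S \<inter> P x = {(c x, a x)}"
      have "(c x, b x) \<notin> S \<inter> P x" "(b x, a x) \<notin> S \<inter> P x" "(c x, a x) \<in> S \<inter> P x"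
        unfolding eq using ord[OF x] by auto
      then have "mixed_triple (\<lambda>x y. (x, y) \<in> S) (a x) (b x) (c x)"
        by (simp add: mixed_triple_def P_def)
      then show False using S ord[OF x] by blast
    qed blast
  qed
  ultimately show ?thesis
    by (simp add: card_cartesian_product) (meson mult_le_mono1 order_trans)
qed

text \<open>Union bound with \<open>p = 16 * q\<close>: there are at most \<open>8 ^ (q * p)\<close>
  sets of size \<open>3 * p\<close>, each failing with probability at most
  \<open>(7/8) ^ (p * p)\<close>.\<close>

lemma ex_colouring:
  assumes q: "0 < q"
  obtains F :: "nat \<Rightarrow> nat \<Rightarrow> bool" where
    "\<And>K. K \<subseteq> {1..2 ^ q} \<Longrightarrow> 48 * q \<le> card K \<Longrightarrow>
       \<exists>a\<in>K. \<exists>b\<in>K. \<exists>c\<in>K. a < b \<and> b < c \<and> mixed_triple F a b c"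
proof -
  define p where "p = 16 * q"
  define V where "V = {1..2 ^ q :: nat}"
  define B where "B K = {S. S \<subseteq> V \<times> V \<and>
      (\<forall>a\<in>K. \<forall>b\<in>K. \<forall>c\<in>K. a < b \<longrightarrow> b < c \<longrightarrow> \<not> mixed_triple (\<lambda>x y. (x, y) \<in> S) a b c)}" for K
  let ?Ks = "{K. K \<subseteq> V \<and> card K = 3 * p}"
  have V: "finite V" "card V = 2 ^ q" by (simp_all add: V_def)
  have "card ?Ks = 2 ^ q choose (3 * p)" using n_subsets[OF V(1)] V(2) by simp
  also have "\<dots> \<le> (2 ^ q) ^ (3 * p)"
    by (cases "3 * p \<le> 2 ^ q") (simp_all add: binomial_le_pow binomial_eq_0)
  also have "\<dots> = (8 ^ q) ^ p"
  proof -
    have "((2 :: nat) ^ q) ^ (3 * p) = ((2 ^ 3) ^ q) ^ p"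
      by (simp only: power_mult[symmetric] mult.assoc mult.commute mult.left_commute)
    then show ?thesis by simp
  qed
  finally have cardKs: "card ?Ks \<le> (8 ^ q) ^ p" .
  have finKs: "finite ?Ks" using V(1) by simp
  have "card (\<Union>K\<in>?Ks. B K) * 8 ^ (p * p) \<le> (\<Sum>K\<in>?Ks. card (B K)) * 8 ^ (p * p)"
    by (intro mult_le_mono1 card_UN_le finKs)
  also have "\<dots> = (\<Sum>K\<in>?Ks. card (B K) * 8 ^ (p * p))" by (rule sum_distrib_right)
  also have "\<dots> \<le> card ?Ks * (7 ^ (p * p) * 2 ^ card (V \<times> V))"
    unfolding B_def
    by (rule sum_bounded_above[where 'a = nat, simplified]) (use card_colourings_without_mixed_triple V in blast)
  also have "\<dots> \<le> (8 ^ q) ^ p * (7 ^ (p * p) * 2 ^ card (V \<times> V))"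
    using cardKs by (rule mult_le_mono1)
  also have "\<dots> = (8 ^ q * 7 ^ p) ^ p * 2 ^ card (V \<times> V)"
    by (simp add: power_mult power_mult_distrib)
  also have "\<dots> < (8 ^ p) ^ p * 2 ^ card (V \<times> V)"
  proof -
    \<comment> \<open>The factor 16 in \<open>p\<close> is the least \<open>m\<close> with
      \<open>8 * 7 ^ m < 8 ^ m\<close>.\<close>
    have "(8 * 7 ^ 16 :: nat) ^ q < (8 ^ 16) ^ q" using q by (intro power_strict_mono) simp_all
    then have "8 ^ q * 7 ^ p < (8 :: nat) ^ p" by (simp only: power_mult_distrib p_def power_mult)
    moreover have "0 < p" using q by (simp add: p_def)
    ultimately have "(8 ^ q * 7 ^ p) ^ p < ((8 :: nat) ^ p) ^ p" by (intro power_strict_mono) simp_all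
    then show ?thesis by simp
  qed
  finally have "card (\<Union>K\<in>?Ks. B K) < card (Pow (V \<times> V))"
    using V by (simp add: power_mult card_Pow)
  moreover have "(\<Union>K\<in>?Ks. B K) \<subseteq> Pow (V \<times> V)" by (auto simp: B_def)
  ultimately obtain S where S: "S \<subseteq> V \<times> V" "\<And>K. K \<in> ?Ks \<Longrightarrow> S \<notin> B K"
    by (metis (no_types, lifting) PowD UN_I less_irrefl subsetI subset_antisym)
  show thesis
  proof (rule that)
    fix K :: "nat set" assume K: "K \<subseteq> {1..2 ^ q}" "48 * q \<le> card K"
    then have "3 * p \<le> card K" by (simp add: p_def)
    then obtain K' where K': "K' \<subseteq> K" "card K' = 3 * p"
      by (rule obtain_subset_with_card_n)
    then have "S \<notin> B K'" using S(2) K(1) by (auto simp: V_def)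
    then show "\<exists>a\<in>K. \<exists>b\<in>K. \<exists>c\<in>K. a < b \<and> b < c \<and> mixed_triple (\<lambda>x y. (x, y) \<in> S) a b c"
      using S(1) K'(1) unfolding B_def by blast
  qed
qed

subsection \<open>Ramsey numbers\<close>

text \<open>Ramsey's theorem ensures that the \<open>LEAST\<close> is attained. If it were some
  \<open>N < M\<close>, restricting \<open>E\<close> to \<open>N\<close> vertices would contradict
  it.\<close>

lemma hyp_ramsey_ge:
  assumes "uniform_hypergraph k {..<M} E" "\<not> has_clique k {..<M} E s" "\<not> has_indep k {..<M} E n"
  shows "M \<le> hyp_ramsey k s n"
proof (rule ccontr)
  let ?P = "\<lambda>N. \<forall>E. uniform_hypergraph k {..<N} E \<longrightarrow> has_clique k {..<N} E s \<or> has_indep k {..<N} E n"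
  define N where "N = hyp_ramsey k s n"
  assume "\<not> M \<le> hyp_ramsey k s n"
  then have less: "{..<N} \<subseteq> {..<M}" by (simp add: N_def)
  obtain R where R: "partn_lst {..<R :: nat} [s, n] k" using ramsey_full by blast
  have "?P R"
  proof (intro allI impI)
    fix E :: "nat set set"
    define f where "f e = (if e \<in> E then 0 else 1 :: nat)" for e
    have "f \<in> nsets {..<R} k \<rightarrow> {..<length [s, n]}" by (simp add: f_def)
    then obtain i where i: "i < 2" "monochromatic {..<R} ([s, n] ! i) k f i"
      using R unfolding partn_lst_def by (metis length_Cons list.size(3) numeral_2_eq_2)
    then obtain H where H: "H \<in> nsets {..<R} ([s, n] ! i)" "f ` nsets H k \<subseteq> {i}"
      by (auto simp: monochromatic_def)
    have fin: "finite H" using H(1) by (simp add: nsets_def)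
    assume E: "uniform_hypergraph k {..<R} E"
    consider "i = 0" | "i = 1" using i(1) by linarith
    then show "has_clique k {..<R} E s \<or> has_indep k {..<R} E n"
    proof cases
      case 1
      have "e \<in> E" if "e \<subseteq> H" "card e = k" for e
      proof -
        have "e \<in> nsets H k" using that fin finite_subset by (auto simp: nsets_def)
        then have "f e = 0" using H(2) 1 by auto
        then show ?thesis by (simp add: f_def split: if_splits)
      qed
      then have "has_clique k {..<R} E s"
        unfolding has_clique_def using H(1) 1 by (auto simp: nsets_def)
      then show ?thesis ..
    next
      case 2
      have "\<not> e \<subseteq> H" if "e \<in> E" for e
      proof
        assume "e \<subseteq> H"
        then have "e \<in> nsets H k"
          using that fin E finite_subset by (auto simp: nsets_def uniform_hypergraph_def)
        then have "f e = 1" using H(2) 2 by auto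
        then show False using that by (simp add: f_def)
      qed
      then have "has_indep k {..<R} E n"
        unfolding has_indep_def using H(1) 2 by (auto simp: nsets_def)
      then show ?thesis ..
    qed
  qed
  then have PN: "?P N" unfolding N_def hyp_ramsey_def by (rule LeastI)
  define E' where "E' = {e \<in> E. e \<subseteq> {..<N}}"
  have "uniform_hypergraph k {..<N} E'"
    using assms(1) by (auto simp: uniform_hypergraph_def E'_def)
  moreover have "\<not> has_clique k {..<N} E' s"
  proof
    assume "has_clique k {..<N} E' s"
    then obtain S where S: "S \<subseteq> {..<N}" "card S = s" "\<forall>e. e \<subseteq> S \<and> card e = k \<longrightarrow> e \<in> E'"
      unfolding has_clique_def by blast
    then have "\<forall>e. e \<subseteq> S \<and> card e = k \<longrightarrow> e \<in> E" by (simp add: E'_def)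
    moreover have "S \<subseteq> {..<M}" using S(1) less by (rule order_trans)
    ultimately show False using assms(2) S(2) unfolding has_clique_def by blast
  qed
  moreover have "\<not> has_indep k {..<N} E' n"
  proof
    assume "has_indep k {..<N} E' n"
    then obtain I where I: "I \<subseteq> {..<N}" "card I = n" "\<forall>e\<in>E'. \<not> e \<subseteq> I"
      unfolding has_indep_def by blast
    then have "\<forall>e\<in>E. \<not> e \<subseteq> I" by (auto simp: E'_def)
    moreover have "I \<subseteq> {..<M}" using I(1) less by (rule order_trans)
    ultimately show False using assms(3) I(2) unfolding has_indep_def by blast
  qed
  ultimately show False using PN by blast
qed

text \<open>The edgeless hypergraph on \<open>n - 1\<close> vertices is a witness. It settles the
  small values of \<open>n\<close>.\<close>

lemma hyp_ramsey_ge_trivial: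
  assumes "k < s"
  shows "n \<le> Suc (hyp_ramsey k s n)"
proof (cases n)
  case (Suc m)
  have "m \<le> hyp_ramsey k s n"
  proof (rule hyp_ramsey_ge[of k m "{}"])
    show "\<not> has_clique k {..<m} {} s"
    proof
      assume "has_clique k {..<m} {} s"
      then obtain S :: "nat set" where "card S = s" "\<forall>e. \<not> (e \<subseteq> S \<and> card e = k)"
        unfolding has_clique_def by auto
      then show False using obtain_subset_with_card_n[of k S] assms by (metis less_imp_le)
    qed
    show "\<not> has_indep k {..<m} {} n"
    proof
      assume "has_indep k {..<m} {} n"
      then obtain I where "I \<subseteq> {..<m}" "card I = n" by (auto simp: has_indep_def)
      then show False using card_mono[of "{..<m}" I] Suc by simp
    qed
  qed (simp add: uniform_hypergraph_def)
  then show ?thesis using Suc by simp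
qed simp

section \<open>The stepped-up hypergraph\<close>

definition quad_edges :: "(nat \<Rightarrow> nat \<Rightarrow> bool) \<Rightarrow> nat \<Rightarrow> nat set set" where
  "quad_edges F M = {{v1, v2, v3, v4} | v1 v2 v3 v4. v1 < v2 \<and> v2 < v3 \<and> v3 < v4 \<and> v4 < M \<and>
      edge_rule F (split_level v1 v2) (split_level v2 v3) (split_level v3 v4)}"

text \<open>A set of four numbers has only one increasing enumeration, so membership determines the
  split levels.\<close>

lemma edge_rule_if_quad_edge:
  assumes "{v1, v2, v3, v4} \<in> quad_edges F M" "v1 < v2" "v2 < v3" "v3 < v4"
  shows "edge_rule F (split_level v1 v2) (split_level v2 v3) (split_level v3 v4)"
proof -
  obtain u1 u2 u3 u4 where u: "{v1, v2, v3, v4} = {u1, u2, u3, u4}" "u1 < u2" "u2 < u3" "u3 < u4"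
    "edge_rule F (split_level u1 u2) (split_level u2 u3) (split_level u3 u4)"
    using assms(1) unfolding quad_edges_def by blast
  have "sorted_list_of_set {v1, v2, v3, v4} = [v1, v2, v3, v4]"
    using assms(2-4) sorted_list_of_set.idem_if_sorted_distinct[of "[v1, v2, v3, v4]"] by simp
  moreover have "sorted_list_of_set {u1, u2, u3, u4} = [u1, u2, u3, u4]"
    using u(2-4) sorted_list_of_set.idem_if_sorted_distinct[of "[u1, u2, u3, u4]"] by simp
  ultimately have "[v1, v2, v3, v4] = [u1, u2, u3, u4]" using u(1) by metis
  then show ?thesis using u(5) by simp
qed

lemma quad_edges_uniform: "uniform_hypergraph 4 {..<M} (quad_edges F M)"
  unfolding uniform_hypergraph_def quad_edges_def by auto

lemma quad_edges_no_clique: "\<not> has_clique 4 {..<M} (quad_edges F M) 5"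
proof
  assume "has_clique 4 {..<M} (quad_edges F M) 5"
  then obtain S where S: "card S = 5" "\<And>e. e \<subseteq> S \<Longrightarrow> card e = 4 \<Longrightarrow> e \<in> quad_edges F M"
    unfolding has_clique_def by blast
  have fin: "finite S" using S(1) card.infinite by fastforce
  define l where "l = sorted_list_of_set S"
  have l: "length l = 5" "set l = S" "sorted_wrt (<) l" using S(1) fin by (simp_all add: l_def)
  obtain v1 v2 v3 v4 v5 where v: "l = [v1, v2, v3, v4, v5]"
    using l(1) by (auto simp: numeral_eq_Suc length_Suc_conv)
  have lt: "v1 < v2" "v2 < v3" "v3 < v4" "v4 < v5" using l(3) v by simp_all
  have edge: "edge_rule F (split_level a b) (split_level b c) (split_level c d)"
    if "{a, b, c, d} \<subseteq> S" "a < b" "b < c" "c < d" for a b c d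
    using that S(2)[of "{a, b, c, d}"] by (intro edge_rule_if_quad_edge) auto
  have "S = {v1, v2, v3, v4, v5}" using l(2) v by auto
  then have "edge_rule F (split_level v1 v2) (split_level v2 v3) (split_level v3 v4)" "edge_rule F (split_level v2 v3) (split_level v3 v4) (split_level v4 v5)"
    "edge_rule F (split_level v1 v3) (split_level v3 v4) (split_level v4 v5)" "edge_rule F (split_level v1 v2) (split_level v2 v4) (split_level v4 v5)"
    "edge_rule F (split_level v1 v2) (split_level v2 v3) (split_level v3 v5)"
    using lt by (auto intro!: edge)
  then show False
    using edge_rule_no_clique split_level_trans lt by metis
qed

lemma quad_edges_no_indep:
  assumes F: "\<And>K. K \<subseteq> {1..D} \<Longrightarrow> t \<le> card K \<Longrightarrow>
       \<exists>a\<in>K. \<exists>b\<in>K. \<exists>c\<in>K. a < b \<and> b < c \<and> mixed_triple F a b c"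
    and n: "2 * t ^ 5 < n"
  shows "\<not> has_indep 4 {..<2 ^ D} (quad_edges F (2 ^ D)) n"
proof
  assume "has_indep 4 {..<2 ^ D} (quad_edges F (2 ^ D)) n"
  then obtain A where A: "A \<subseteq> {..<2 ^ D}" "card A = n" "\<And>e. e \<in> quad_edges F (2 ^ D) \<Longrightarrow> \<not> e \<subseteq> A"
    unfolding has_indep_def by blast
  have fin: "finite A" using A(1) finite_subset by blast
  have ind: "indep_set F A"
    unfolding indep_set_def
  proof (intro ballI impI notI)
    fix v1 v2 v3 v4
    assume "v1 \<in> A" "v2 \<in> A" "v3 \<in> A" "v4 \<in> A" "v1 < v2" "v2 < v3" "v3 < v4"
      and "edge_rule F (split_level v1 v2) (split_level v2 v3) (split_level v3 v4)"
    moreover from this have "{v1, v2, v3, v4} \<in> quad_edges F (2 ^ D)"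
      using A(1) unfolding quad_edges_def by blast
    ultimately show False using A(3)[of "{v1, v2, v3, v4}"] by auto
  qed
  \<comment> \<open>Levels with equal turns towards \<open>e\<close> contain no mixed triple,
    whereas \<open>F\<close> puts one into any \<open>t\<close> levels.\<close>
  have "card {y. anc A d e y} < t" if e: "e \<in> A" for d e
  proof (rule ccontr)
    assume "\<not> card {y. anc A d e y} < t"
    then have "t \<le> card {y. anc A d e y}" by simp
    moreover have "{y. anc A d e y} \<subseteq> {1..D}"
    proof
      fix y assume "y \<in> {y. anc A d e y}"
      then obtain u where u: "u \<in> A" "u \<noteq> e" "split_level u e = y" using before_irrefl by (auto simp: anc_def)
      then show "y \<in> {1..D}" using split_level_pos[of u e] split_level_le[of u D e] A(1) e by auto
    qed
    ultimately show False using F[of "{y. anc A d e y}"] anc_same[OF ind e] by blast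
  qed
  then have "card A \<le> 2 * t ^ 5" by (rule card_indep_set_le[OF fin ind])
  then show False using A(2) n by simp
qed

lemma hyp_ramsey_4_5_ge:
  assumes "0 < q" "2 * (48 * q) ^ 5 < n"
  shows "2 ^ 2 ^ q \<le> hyp_ramsey 4 5 n"
proof -
  obtain F where F: "\<And>K. K \<subseteq> {1..2 ^ q} \<Longrightarrow> 48 * q \<le> card K \<Longrightarrow>
       \<exists>a\<in>K. \<exists>b\<in>K. \<exists>c\<in>K. a < b \<and> b < c \<and> mixed_triple F a b c"
    using ex_colouring[OF assms(1)] by metis
  show ?thesis
    by (rule hyp_ramsey_ge[OF quad_edges_uniform[of _ F] quad_edges_no_clique quad_edges_no_indep[OF F assms(2)]])
qed

theorem theorem1p2:
  shows "\<exists>c::real. c > 0 \<and> (\<forall>n::nat. n \<ge> 5 \<longrightarrow>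
           real (hyp_ramsey 4 5 n) \<ge> 2 powr (2 powr (c * real n powr (1/5))))"
proof (intro exI conjI allI impI)
  show "(0 :: real) < 1 / 200" by simp
  fix n :: nat
  assume n: "5 \<le> n"
  define x where "x = 1 / 200 * real n powr (1/5)"
  have x5: "(200 * x) ^ 5 = real n"
    using n by (simp add: x_def powr_realpow[symmetric] powr_powr)
  show "2 powr (2 powr x) \<le> real (hyp_ramsey 4 5 n)"
  \<comment> \<open>For \<open>x \<le> 1\<close> the claimed bound is at most 4, hence at most
    \<open>n - 1\<close>.\<close>
  proof (cases "x \<le> 1")
    case True
    then have "2 powr x \<le> (2 :: real) powr 1" by (intro powr_mono) auto
    then have "2 powr (2 powr x) \<le> (2 :: real) powr 2" by (intro powr_mono) auto
    also have "\<dots> \<le> real (hyp_ramsey 4 5 n)"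
      using hyp_ramsey_ge_trivial[of 4 5 n] n by simp
    finally show ?thesis .
  next
    case False
    \<comment> \<open>As \<open>x > 1\<close>, rounding up at most doubles \<open>x\<close>; the
      constant 200 then suffices because \<open>2 * 96 ^ 5 < 200 ^ 5\<close>.\<close>
    define q where "q = nat \<lceil>x\<rceil>"
    have q: "x \<le> real q" "real q < 2 * x" "0 < q" using False unfolding q_def by linarith+
    have "real (48 * q) ^ 5 \<le> (96 * x) ^ 5"
      using q(2) by (intro power_mono) simp_all
    then have "real (2 * (48 * q) ^ 5) \<le> 2 * (96 * x) ^ 5" by simp
    also have "\<dots> < (200 * x) ^ 5" using False by (simp add: power_mult_distrib)
    finally have "2 * (48 * q) ^ 5 < n" using x5 by linarith
    then have ge: "2 ^ 2 ^ q \<le> hyp_ramsey 4 5 n" by (rule hyp_ramsey_4_5_ge[OF q(3)])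
    have "2 powr x \<le> 2 powr real q" using q(1) by (intro powr_mono) auto
    also have "\<dots> = real (2 ^ q)" by (simp add: powr_realpow)
    finally have "2 powr (2 powr x) \<le> 2 powr real (2 ^ q)" by (intro powr_mono) auto
    also have "\<dots> = real (2 ^ 2 ^ q)" by (subst powr_realpow) simp_all
    also have "\<dots> \<le> real (hyp_ramsey 4 5 n)" using ge by (rule of_nat_mono)
    finally show ?thesis .
  qed
qed

end
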